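(* Let $F$ be a field of characteristic not $2$, let $B$ and $B'$ be central simple division algebras over $F$, let $\sigma\in\mathrm{Aut}_F(B)$ and $\phi\in\mathrm{Aut}_F(B')$ be non-trivial automorphisms, and let $c\in B^{\times}$, $d\in B'^{\times}$. Put $D=D(B,\sigma,c)$ and $D'=D(B',\phi,d)$. Then a map $G:D\to D'$ is an isomorphism of $F$-algebras if and only if $G$ has the form $$G(x,y)=(\tau(x),\tau(y)b)\qquad(x,y\in B)$$ for some $F$-isomorphism $\tau:B\to B'$ and some $b\in F^{\times}$ such that $\phi\circ\tau=\tau\circ\sigma$ and $\tau(c)=db^2$.
   Context: For a central simple algebra $B$ over $F$, $\sigma\in\mathrm{Aut}_F(B)$ and $c\in B^{\times}$, $D(B,\sigma,c)$ denotes the $F$-vector space $B\oplus B$ with multiplication $(u,v)(x,y)=(ux+c\,\sigma(vy),\,uy+vx)$ for $u,v,x,y\in B$; it is a unital nonassociative $F$-algebra. *)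

theory Defs
  imports "HOL-Analysis.Product_Vector"
begin

text \<open>
  An algebra over a field is given by its scalar multiplication \<open>s\<close> and its multiplication
  \<open>m\<close>; associativity is not required, so that the doubled algebras below are covered.
\<close>

locale nonassoc_algebra = vector_space s
  for s :: "'f::field \<Rightarrow> 'a::ab_group_add \<Rightarrow> 'a"
  and m :: "'a \<Rightarrow> 'a \<Rightarrow> 'a" +
  assumes mult_add_left: "m (x + y) z = m x z + m y z"
    and mult_add_right: "m x (y + z) = m x y + m x z"
    and mult_scale_left: "m (s a x) y = s a (m x y)"
    and mult_scale_right: "m x (s a y) = s a (m x y)"

text \<open>A bijective multiplicative map between unital algebras preserves the identity, so this need
  not be demanded.\<close>

definition algebra_isomorphism ::
    "('f::field \<Rightarrow> 'a::ab_group_add \<Rightarrow> 'a) \<Rightarrow> ('a \<Rightarrow> 'a \<Rightarrow> 'a) \<Rightarrow>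
     ('f \<Rightarrow> 'b::ab_group_add \<Rightarrow> 'b) \<Rightarrow> ('b \<Rightarrow> 'b \<Rightarrow> 'b) \<Rightarrow> ('a \<Rightarrow> 'b) \<Rightarrow> bool"
  where "algebra_isomorphism s m s' m' f \<longleftrightarrow>
    Vector_Spaces.linear s s' f \<and> bij f \<and> (\<forall>x y. f (m x y) = m' (f x) (f y))"

definition two_sided_unit :: "'b::ring_1 \<Rightarrow> bool"
  where "two_sided_unit x \<longleftrightarrow> (\<exists>y. x * y = 1 \<and> y * x = 1)"

definition two_sided_ideal :: "'b::ring_1 set \<Rightarrow> bool"
  where "two_sided_ideal I \<longleftrightarrow>
    0 \<in> I \<and> (\<forall>x\<in>I. \<forall>y\<in>I. x + y \<in> I) \<and> (\<forall>x\<in>I. \<forall>r. r * x \<in> I \<and> x * r \<in> I)"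

locale central_simple_algebra = nonassoc_algebra s "(*)"
  for s :: "'f::field \<Rightarrow> 'b::ring_1 \<Rightarrow> 'b" +
  assumes finite_dim: "\<exists>S. finite S \<and> span S = UNIV"
    and simple: "two_sided_ideal (I :: 'b set) \<Longrightarrow> I = {0} \<or> I = UNIV"
    and central: "{z :: 'b. \<forall>x. z * x = x * z} = range (\<lambda>a. s a 1)"

locale central_simple_division_algebra = central_simple_algebra s
  for s :: "'f::field \<Rightarrow> 'b::ring_1 \<Rightarrow> 'b" +
  assumes division: "(x :: 'b) \<noteq> 0 \<Longrightarrow> two_sided_unit x"

definition algebra_automorphism ::
    "('f::field \<Rightarrow> 'b::ring_1 \<Rightarrow> 'b) \<Rightarrow> ('b \<Rightarrow> 'b) \<Rightarrow> bool"
  where "algebra_automorphism s \<sigma> \<longleftrightarrow> algebra_isomorphism s (*) s (*) \<sigma>"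

text \<open>
  The algebra \<open>D(B, \<sigma>, c)\<close> lives on the type \<open>'b \<times> 'b\<close>, with the componentwise addition of
  products, the scalar multiplication \<open>D_scale\<close> and the multiplication \<open>D_mult\<close>.
\<close>

abbreviation D_scale :: "('f::field \<Rightarrow> 'b::ring_1 \<Rightarrow> 'b) \<Rightarrow> 'f \<Rightarrow> 'b \<times> 'b \<Rightarrow> 'b \<times> 'b"
  where "D_scale s \<equiv> module_prod.scale s s"

definition D_mult :: "('b::ring_1 \<Rightarrow> 'b) \<Rightarrow> 'b \<Rightarrow> 'b \<times> 'b \<Rightarrow> 'b \<times> 'b \<Rightarrow> 'b \<times> 'b"
  where "D_mult \<sigma> c = (\<lambda>(u, v) (x, y). (u * x + c * \<sigma> (v * y), u * y + v * x))"

lemma nonassoc_algebra_D: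
  assumes "central_simple_algebra s" "algebra_automorphism s \<sigma>"
  shows "nonassoc_algebra (D_scale s) (D_mult \<sigma> c)"
proof -
  interpret B: central_simple_algebra s by fact
  interpret \<sigma>: Vector_Spaces.linear s s \<sigma>
    using assms(2) by (simp add: algebra_automorphism_def algebra_isomorphism_def)
  interpret P: vector_space_prod s s by unfold_locales
  show ?thesis
    by unfold_locales
      (auto simp: D_mult_def P.scale_def B.mult_add_left B.mult_add_right B.mult_scale_left
        B.mult_scale_right \<sigma>.add \<sigma>.scale B.scale_right_distrib B.scale_left_distrib
        distrib_left distrib_right)
qed

lemma D_mult_one:
  assumes "algebra_automorphism s \<sigma>"
  shows "D_mult \<sigma> c (1, 0) p = p" "D_mult \<sigma> c p (1, 0) = p"
proof -
  interpret \<sigma>: Vector_Spaces.linear s s \<sigma>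
    using assms by (simp add: algebra_automorphism_def algebra_isomorphism_def)
  show "D_mult \<sigma> c (1, 0) p = p" "D_mult \<sigma> c p (1, 0) = p"
    by (simp_all add: D_mult_def split: prod.split)
qed

end

theory Submission
  imports Defs
begin

text \<open>
  The middle nucleus of \<open>D(B, \<sigma>, c)\<close> is \<open>B \<times> {0}\<close> as soon as \<open>\<sigma>\<close> is non-trivial, so an
  isomorphism \<open>G\<close> restricts to an isomorphism \<open>\<tau> : B \<rightarrow> B'\<close>. Since \<open>(0, 1)\<close> commutes with
  \<open>B \<times> {0}\<close>, its image has central entries \<open>(a, b)\<close>, i.e. entries in \<open>F\<close>. Its square \<open>(c, 0)\<close>
  has second entry zero, so \<open>2ab = 0\<close> and thus \<open>a = 0\<close>. The remaining
  conditions are read off the images of the products \<open>(0, 1)(0, y) = (c \<sigma>(y), 0)\<close>.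
\<close>

definition middle_nucleus :: "('a \<Rightarrow> 'a \<Rightarrow> 'a) \<Rightarrow> 'a set"
  where "middle_nucleus m = {q. \<forall>p r. m (m p q) r = m p (m q r)}"

text \<open>Surjectivity of \<open>f\<close> lets the two outer factors in \<open>m'\<close> be
  written as images \<open>f p\<close> and \<open>f r\<close>; injectivity then reflects the
  associativity equation back to \<open>m\<close>.\<close>

lemma middle_nucleus_isomorphism:
  assumes "algebra_isomorphism s m s' m' f"
  shows "f q \<in> middle_nucleus m' \<longleftrightarrow> q \<in> middle_nucleus m"
proof -
  have bij: "bij f" and mult: "f (m x y) = m' (f x) (f y)" for x y
    using assms by (auto simp: algebra_isomorphism_def)
  have "f q \<in> middle_nucleus m' \<longleftrightarrow>
      (\<forall>p r. m' (m' (f p) (f q)) (f r) = m' (f p) (m' (f q) (f r)))"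
    unfolding middle_nucleus_def mem_Collect_eq using bij_is_surj[OF bij] by (metis surjD)
  also have "\<dots> \<longleftrightarrow> (\<forall>p r. f (m (m p q) r) = f (m p (m q r)))"
    by (simp add: mult)
  also have "\<dots> \<longleftrightarrow> q \<in> middle_nucleus m"
    using bij_is_inj[OF bij] by (simp add: middle_nucleus_def inj_eq)
  finally show ?thesis .
qed

lemma two_sided_unit_mult_left_cancel:
  "two_sided_unit x \<Longrightarrow> x * y = x * z \<longleftrightarrow> y = z"
  unfolding two_sided_unit_def by (metis mult.assoc mult_1)

lemma algebra_isomorphism_one:
  fixes f :: "'a::ring_1 \<Rightarrow> 'b::ring_1"
  assumes "algebra_isomorphism s (*) s' (*) f"
  shows "f 1 = 1"
proof -
  have mult: "f (x * y) = f x * f y" for x y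
    using assms by (auto simp: algebra_isomorphism_def)
  obtain e where e: "f e = 1"
    using assms unfolding algebra_isomorphism_def by (metis bij_is_surj surjD)
  have "f 1 = f 1 * f e" by (simp add: e)
  also have "\<dots> = f e" by (simp flip: mult)
  finally show ?thesis using e by simp
qed

context central_simple_algebra
begin

lemma scale_one_mult [simp]: "s a 1 * x = s a x" "x * s a 1 = s a x"
  by (simp_all add: mult_scale_left mult_scale_right)

lemma central_imp_scalar:
  assumes "\<And>x. z * x = x * z"
  obtains a where "z = s a 1"
  using central assms by blast

end

text \<open>Elements \<open>(x, 0)\<close> associate in the middle because the product on
  \<open>'b\<close> is associative. For \<open>y \<noteq> 0\<close>, testing \<open>(x, y)\<close>
  between \<open>(0, v)\<close> and \<open>(z, 0)\<close> would force \<sigma> to fix every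
  \<open>z\<close>.\<close>

lemma (in central_simple_division_algebra) middle_nucleus_D:
  assumes aut: "algebra_automorphism s \<sigma>" and "\<sigma> \<noteq> id" and unit: "two_sided_unit c"
  shows "middle_nucleus (D_mult \<sigma> c) = UNIV \<times> {0}"
proof (intro equalityI subsetI)
  interpret \<sigma>: Vector_Spaces.linear s s \<sigma>
    using aut by (simp add: algebra_automorphism_def algebra_isomorphism_def)
  have one: "\<sigma> 1 = 1"
    using aut algebra_isomorphism_one unfolding algebra_automorphism_def by blast
  fix q :: "'b \<times> 'b"
  obtain x y where q: "q = (x, y)" by fastforce
  {
    assume "q \<in> middle_nucleus (D_mult \<sigma> c)"
    then have assoc: "D_mult \<sigma> c (D_mult \<sigma> c (0, v) q) (z, 0) = D_mult \<sigma> c (0, v) (D_mult \<sigma> c q (z, 0))"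
      for v z
      by (auto simp: middle_nucleus_def)
    have "y = 0"
    proof (rule ccontr)
      assume "y \<noteq> 0"
      then obtain v where v: "v * y = 1"
        using division unfolding two_sided_unit_def by blast
      have "\<sigma> z = z" for z
      proof -
        \<comment> \<open>Since \<open>v * y = 1\<close>, these are the first components of the two
          bracketings.\<close>
        have "c * z = c * \<sigma> z"
          using assoc[of v z]
          by (simp add: q D_mult_def v one flip: mult.assoc)
        then show ?thesis
          using two_sided_unit_mult_left_cancel[OF unit] by metis
      qed
      with \<open>\<sigma> \<noteq> id\<close> show False by auto
    qed
    then show "q \<in> UNIV \<times> {0}" by (simp add: q)
  next
    assume "q \<in> UNIV \<times> {0}"
    then show "q \<in> middle_nucleus (D_mult \<sigma> c)"
      by (auto simp: middle_nucleus_def D_mult_def algebra_simps \<sigma>.add)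
  }
qed

theorem theorem3p12:
  fixes s :: "'f::field \<Rightarrow> 'b::ring_1 \<Rightarrow> 'b"
    and s' :: "'f \<Rightarrow> 'c::ring_1 \<Rightarrow> 'c"
    and \<sigma> :: "'b \<Rightarrow> 'b" and \<phi> :: "'c \<Rightarrow> 'c"
    and c :: 'b and d :: 'c
    and G :: "'b \<times> 'b \<Rightarrow> 'c \<times> 'c"
  assumes "CHAR('f) \<noteq> 2"
    and "central_simple_division_algebra s"
    and "central_simple_division_algebra s'"
    and "algebra_automorphism s \<sigma>" and "\<sigma> \<noteq> id"
    and "algebra_automorphism s' \<phi>" and "\<phi> \<noteq> id"
    and "two_sided_unit c" and "two_sided_unit d"
  shows "algebra_isomorphism (D_scale s) (D_mult \<sigma> c) (D_scale s') (D_mult \<phi> d) G \<longleftrightarrow>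
    (\<exists>\<tau> b. algebra_isomorphism s (*) s' (*) \<tau> \<and> b \<noteq> 0 \<and>
      \<phi> \<circ> \<tau> = \<tau> \<circ> \<sigma> \<and> \<tau> c = d * (s' b 1)^2 \<and>
      (\<forall>x y. G (x, y) = (\<tau> x, \<tau> y * s' b 1)))"
proof
  interpret B: central_simple_division_algebra s by fact
  interpret C: central_simple_division_algebra s' by fact
  interpret P: vector_space_prod s s by unfold_locales
  interpret Q: vector_space_prod s' s' by unfold_locales
  interpret \<sigma>: Vector_Spaces.linear s s \<sigma>
    using assms(4) by (simp add: algebra_automorphism_def algebra_isomorphism_def)
  interpret \<phi>: Vector_Spaces.linear s' s' \<phi>
    using assms(6) by (simp add: algebra_automorphism_def algebra_isomorphism_def)
  have \<sigma>_one: "\<sigma> 1 = 1" and \<phi>_one: "\<phi> 1 = 1"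
    using assms(4,6) algebra_isomorphism_one unfolding algebra_automorphism_def by blast+
  {
    assume iso: "algebra_isomorphism (D_scale s) (D_mult \<sigma> c) (D_scale s') (D_mult \<phi> d) G"
    interpret G: Vector_Spaces.linear "D_scale s" "D_scale s'" G
      using iso by (simp add: algebra_isomorphism_def)
    have bij: "bij G" and mult: "G (D_mult \<sigma> c p q) = D_mult \<phi> d (G p) (G q)" for p q
      using iso unfolding algebra_isomorphism_def by blast+
    \<comment> \<open>Both middle nuclei consist of the pairs with second component zero, so
      \<open>G\<close> preserves and reflects this property.\<close>
    have nucleus: "snd (G p) = 0 \<longleftrightarrow> snd p = 0" for p
      using middle_nucleus_isomorphism[OF iso, of p]
      unfolding B.middle_nucleus_D[OF assms(4,5,8)] C.middle_nucleus_D[OF assms(6,7,9)]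
      by (simp add: mem_Times_iff)
    define \<tau> where "\<tau> x = fst (G (x, 0))" for x
    have G_left: "G (x, 0) = (\<tau> x, 0)" for x
      using nucleus[of "(x, 0)"] by (simp add: \<tau>_def prod_eq_iff)
    have \<tau>_mult: "\<tau> (x * y) = \<tau> x * \<tau> y" for x y
      using mult[of "(x, 0)" "(y, 0)"] by (simp add: D_mult_def G_left)
    \<comment> \<open>A preimage of \<open>(z, 0)\<close> under \<open>G\<close> again has second
      component zero, so its first component is a preimage of \<open>z\<close> under \<tau>.\<close>
    have surj: "\<exists>x. \<tau> x = z" for z
    proof -
      obtain p where p: "G p = (z, 0)"
        using bij by (metis bij_is_surj surjD)
      with nucleus[of p] have "p = (fst p, 0)" by (simp add: prod_eq_iff)
      with p G_left[of "fst p"] show ?thesis by auto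
    qed
    have \<tau>: "algebra_isomorphism s (*) s' (*) \<tau>"
      unfolding algebra_isomorphism_def
    proof (intro conjI allI)
      show "Vector_Spaces.linear s s' \<tau>"
      proof (unfold_locales)
        show "\<tau> (x + y) = \<tau> x + \<tau> y" for x y
          using G.add[of "(x, 0)" "(y, 0)"] by (simp add: G_left)
        show "\<tau> (s r x) = s' r (\<tau> x)" for r x
          using G.scale[of r "(x, 0)"] by (simp add: G_left P.scale_def Q.scale_def)
      qed
      have "inj \<tau>"
      proof (rule injI)
        fix x y assume "\<tau> x = \<tau> y"
        then have "G (x, 0) = G (y, 0)" by (simp add: G_left)
        with bij show "x = y" by (auto simp: bij_def inj_eq)
      qed
      with surj show "bij \<tau>" by (metis bijI surjI)
    qed (rule \<tau>_mult)
    obtain a' b' where ab: "G (0, 1) = (a', b')" by fastforce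
    \<comment> \<open>Both products of \<open>(x, 0)\<close> and \<open>(0, 1)\<close> equal
      \<open>(0, x)\<close>. Comparing the two resulting formulas shows that \<open>a'\<close> and
      \<open>b'\<close> commute with the range of \<tau>, hence with everything.\<close>
    have G_right: "G (0, x) = (\<tau> x * a', \<tau> x * b')" "G (0, x) = (a' * \<tau> x, b' * \<tau> x)" for x
      using mult[of "(x, 0)" "(0, 1)"] mult[of "(0, 1)" "(x, 0)"]
      by (simp_all add: D_mult_def G_left ab)
    have "a' * z = z * a' \<and> b' * z = z * b'" for z
      using surj[of z] G_right by (metis prod.inject)
    then obtain a b where a: "a' = s' a 1" and b: "b' = s' b 1"
      using C.central_imp_scalar by metis
    have "b' \<noteq> 0"
      using nucleus[of "(0, 1)"] by (simp add: ab)
    then have "b \<noteq> 0" by (auto simp: b)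
    \<comment> \<open>If 2 were zero, the characteristic would divide 2; as a field cannot have
      characteristic 1, it would be 2.\<close>
    have "(2::'f) \<noteq> 0"
    proof
      assume "(2::'f) = 0"
      then have "CHAR('f) dvd 2"
        using of_nat_eq_0_iff_char_dvd[of 2, where 'a = 'f] by simp
      then have "CHAR('f) \<le> 2" and "CHAR('f) \<noteq> 0"
        by (simp_all only: dvd_imp_le zero_less_numeral) (metis dvd_0_left zero_neq_numeral)
      moreover have "CHAR('f) \<noteq> 1"
        by simp
      ultimately show False
        using \<open>CHAR('f) \<noteq> 2\<close> by linarith
    qed
    \<comment> \<open>The entry \<open>b'\<close> is a scalar, so it passes through the linear map
      \<phi>.\<close>
    have \<phi>_b: "\<phi> (b' * (b' * z)) = b' * (b' * \<phi> z)" for z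
      by (simp add: b \<phi>.scale)
    \<comment> \<open>Comparing second components gives \<open>a = 0\<close>; the first components
      then yield the formula for \<open>\<tau> c\<close>.\<close>
    have square: "(\<tau> c, 0) = (a' * a' + d * \<phi> (b' * b'), a' * b' + b' * a')"
      using mult[of "(0, 1)" "(0, 1)"] \<sigma>_one by (simp add: D_mult_def G_left ab)
    then have "s' (2 * (a * b)) 1 = 0"
      by (simp add: a b mult.commute flip: C.scale_left_distrib)
    with \<open>2 \<noteq> 0\<close> \<open>b \<noteq> 0\<close> have "a = 0" by simp
    then have "a' = 0" by (simp add: a)
    have \<tau>_c: "\<tau> c = d * b'^2"
      using square \<phi>_b[of 1] by (simp add: \<open>a' = 0\<close> \<phi>_one power2_eq_square)
    have "\<phi> (\<tau> y) = \<tau> (\<sigma> y)" for y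
    proof -
      \<comment> \<open>These are the first components of the image of \<open>(0, 1)\<close> times
        \<open>(0, y)\<close>. After inserting the value of \<open>\<tau> c\<close>, the unit
        \<open>d\<close> and the nonzero scalar \<open>b * b\<close> cancel.\<close>
      have "\<tau> c * \<tau> (\<sigma> y) = d * \<phi> (b' * (b' * \<tau> y))"
        using mult[of "(0, 1)" "(0, y)"]
        by (simp add: D_mult_def G_left ab G_right(2) \<open>a' = 0\<close> \<tau>_mult
            algebra_isomorphism_one[OF \<tau>])
      then have "d * s' (b * b) (\<tau> (\<sigma> y)) = d * s' (b * b) (\<phi> (\<tau> y))"
        by (simp add: \<phi>_b \<tau>_c b power2_eq_square mult.assoc \<phi>.scale
            C.mult_scale_left C.mult_scale_right)
      then show ?thesis
        using \<open>b \<noteq> 0\<close> by (simp add: two_sided_unit_mult_left_cancel[OF assms(9)])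
    qed
    then have "\<phi> \<circ> \<tau> = \<tau> \<circ> \<sigma>" by auto
    moreover have "G (x, y) = (\<tau> x, \<tau> y * s' b 1)" for x y
      using G.add[of "(x, 0)" "(0, y)"] by (simp add: G_left G_right(1) \<open>a' = 0\<close> b)
    ultimately show "\<exists>\<tau> b. algebra_isomorphism s (*) s' (*) \<tau> \<and> b \<noteq> 0 \<and>
        \<phi> \<circ> \<tau> = \<tau> \<circ> \<sigma> \<and> \<tau> c = d * (s' b 1)^2 \<and>
        (\<forall>x y. G (x, y) = (\<tau> x, \<tau> y * s' b 1))"
      using \<tau> \<open>b \<noteq> 0\<close> \<tau>_c b by blast
  next
    assume "\<exists>\<tau> b. algebra_isomorphism s (*) s' (*) \<tau> \<and> b \<noteq> 0 \<and>
        \<phi> \<circ> \<tau> = \<tau> \<circ> \<sigma> \<and> \<tau> c = d * (s' b 1)^2 \<and>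
        (\<forall>x y. G (x, y) = (\<tau> x, \<tau> y * s' b 1))"
    \<comment> \<open>Right multiplication by \<open>s' b 1\<close> is recorded as the scalar action
      of \<open>b\<close>, so that linearity applies throughout this direction.\<close>
    then obtain \<tau> b where \<tau>: "algebra_isomorphism s (*) s' (*) \<tau>" and "b \<noteq> 0"
      and comm: "\<phi> \<circ> \<tau> = \<tau> \<circ> \<sigma>" and \<tau>_c: "\<tau> c = d * (s' b 1)^2"
      and G: "\<And>x y. G (x, y) = (\<tau> x, s' b (\<tau> y))"
      by auto
    interpret \<tau>: Vector_Spaces.linear s s' \<tau>
      using \<tau> by (simp add: algebra_isomorphism_def)
    have \<tau>_bij: "bij \<tau>" and \<tau>_mult: "\<tau> (x * y) = \<tau> x * \<tau> y" for x y
      using \<tau> by (auto simp: algebra_isomorphism_def)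
    have comm': "\<phi> (\<tau> x) = \<tau> (\<sigma> x)" for x
      using comm by (metis comp_apply)
    \<comment> \<open>The product of two second components \<open>s' b (\<tau> v)\<close> and
      \<open>s' b (\<tau> y)\<close> carries the scalar \<open>b * b\<close>; the condition on
      \<open>\<tau> c\<close> supplies the same scalar on the other side.\<close>
    have \<tau>_c_mult: "\<tau> (c * x) = s' (b * b) (d * \<tau> x)" for x
      by (simp add: \<tau>_mult \<tau>_c power2_eq_square C.mult_scale_left C.mult_scale_right)
    show "algebra_isomorphism (D_scale s) (D_mult \<sigma> c) (D_scale s') (D_mult \<phi> d) G"
      unfolding algebra_isomorphism_def
    proof (intro conjI allI)
      show "Vector_Spaces.linear (D_scale s) (D_scale s') G"
        by unfold_locales
          (auto simp: G P.scale_def Q.scale_def \<tau>.add \<tau>.scale C.scale_right_distrib mult.commute)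
      show "bij G"
      proof (rule bijI)
        show "inj G"
          using \<tau>_bij \<open>b \<noteq> 0\<close> by (auto intro!: injI simp: G bij_def inj_eq)
        have "\<exists>p. (z, w) = G p" for z w
        proof -
          \<comment> \<open>The second coordinate of the preimage undoes the scaling by
            \<open>b\<close>.\<close>
          obtain x y where "\<tau> x = z" "\<tau> y = s' (inverse b) w"
            using \<tau>_bij by (metis bij_is_surj surjD)
          then have "G (x, y) = (z, w)" using \<open>b \<noteq> 0\<close> by (simp add: G)
          then show ?thesis by metis
        qed
        then show "surj G" by (auto simp: surj_def)
      qed
      \<comment> \<open>In the first component \<open>comm'\<close> exchanges \<phi> and \<sigma>;
        in the second, each term has exactly one factor scaled by \<open>b\<close>.\<close>
      show "G (D_mult \<sigma> c p q) = D_mult \<phi> d (G p) (G q)" for p q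
        by (cases p; cases q)
          (simp add: D_mult_def G \<tau>.add \<tau>_c_mult comm' \<phi>.scale
            C.mult_scale_left C.mult_scale_right C.scale_right_distrib flip: \<tau>_mult)
    qed
  }
qed

end
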